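(* For each $n\ge 1$, let $\lambda_n$ be a partition of a positive integer $N_n$, with conjugate partition $\lambda_n'$, and regard $\lambda_n = (\lambda_{n,1}, \lambda_{n,2},\ldots)$ and $\lambda_n' = (\lambda_{n,1}',\lambda_{n,2}',\ldots)$ as infinite nonincreasing sequences of nonnegative integers by appending zeros. Suppose that $N_n\to\infty$ as $n\to\infty$ and that $$\lim_{n\to\infty}\frac{\lambda_{n,i}}{N_n} = p_i \quad\text{and}\quad \lim_{n\to\infty}\frac{\lambda'_{n,j}}{N_n} = q_j$$ for all $i,j\ge 1$. Then $$\lim_{n\to\infty} \frac{\sum_{(i,j)\in\lambda_n}(j-i)}{\binom{N_n}{2}} = \lim_{n\to\infty} \frac{\sum_i \binom{\lambda_{n,i}}{2} - \sum_j \binom{\lambda'_{n,j}}{2}}{\binom{N_n}{2}}$$ exists and equals $$\theta = \sum_i p_i^2 - \sum_j q_j^2 .$$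
   Context: A partition $\lambda$ of a positive integer $N$ is a sequence of integers $\lambda_1 \ge \lambda_2 \ge \cdots \ge \lambda_k > 0$ with sum $N$. Its Young diagram has $\lambda_i$ boxes in row $i$; $(i,j)\in\lambda$ means $1\le i\le k$ and $1\le j\le\lambda_i$. The conjugate partition $\lambda'$ is the one whose Young diagram is the transpose: $(i,j)\in\lambda'$ if and only if $(j,i)\in\lambda$. *)

theory Defs
  imports "HOL-Analysis.Analysis"
begin

definition partition_of :: "nat \<Rightarrow> nat list \<Rightarrow> bool" where
  "partition_of N xs \<longleftrightarrow> sorted_wrt (\<ge>) xs \<and> (\<forall>x \<in> set xs. x > 0) \<and> sum_list xs = N"

(* Parts are indexed from 1 and padded by zeros; the value at index 0 is irrelevant. *)
definition nth_part :: "nat list \<Rightarrow> nat \<Rightarrow> nat" where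
  "nth_part xs i = (if 1 \<le> i \<and> i \<le> length xs then xs ! (i - 1) else 0)"

definition young_diagram :: "nat list \<Rightarrow> (nat \<times> nat) set" where
  "young_diagram xs = {(i, j). 1 \<le> i \<and> i \<le> length xs \<and> 1 \<le> j \<and> j \<le> nth_part xs i}"

definition conjugate :: "nat list \<Rightarrow> nat list" where
  "conjugate xs = (THE ys. (\<exists>M. partition_of M ys) \<and>
     (\<forall>i j. (i, j) \<in> young_diagram ys \<longleftrightarrow> (j, i) \<in> young_diagram xs))"

lemma nth_part_antimono:
  assumes "partition_of N xs" "1 \<le> i" "i \<le> k"
  shows "nth_part xs k \<le> nth_part xs i"
proof (cases "i = k \<or> length xs < k")
  case False
  then have "i - 1 < k - 1" "k - 1 < length xs" using assms by auto
  then have "xs ! (k - 1) \<le> xs ! (i - 1)"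
    using assms(1) unfolding partition_of_def by (meson sorted_wrt_nth_less)
  then show ?thesis using False assms by (auto simp: nth_part_def)
qed (auto simp: nth_part_def)

lemma nth_part_pos:
  assumes "partition_of N xs" "1 \<le> i" "i \<le> length xs"
  shows "nth_part xs i > 0"
proof -
  have "xs ! (i - 1) \<in> set xs" using assms(2,3) by (intro nth_mem) auto
  then show ?thesis using assms by (auto simp: nth_part_def partition_of_def)
qed

lemma mem_young_diagram:
  "(i, j) \<in> young_diagram xs \<longleftrightarrow> 1 \<le> i \<and> 1 \<le> j \<and> j \<le> nth_part xs i"
  by (auto simp: young_diagram_def nth_part_def split: if_splits)

lemma partition_eq_if_diagram_eq:
  assumes x: "partition_of M xs" and y: "partition_of N ys"
    and eq: "young_diagram xs = young_diagram ys"
  shows "xs = ys"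
proof -
  have le: "nth_part us i \<le> nth_part vs i" if "young_diagram us = young_diagram vs" "1 \<le> i" for us vs i
  proof (cases "nth_part us i = 0")
    case False
    then have "(i, nth_part us i) \<in> young_diagram us" using that(2) by (simp add: mem_young_diagram)
    then have "(i, nth_part us i) \<in> young_diagram vs" using that(1) by simp
    then show ?thesis by (simp add: mem_young_diagram)
  qed simp
  have p: "nth_part xs i = nth_part ys i" if "1 \<le> i" for i
    using le[OF eq that] le[OF eq[symmetric] that] by simp
  have len: "length us \<le> length vs"
    if "partition_of K us" "\<And>i. 1 \<le> i \<Longrightarrow> nth_part us i = nth_part vs i" for us vs K
  proof (rule ccontr)
    assume "\<not> ?thesis"
    then have "nth_part us (length us) > 0" "nth_part vs (length us) = 0" "1 \<le> length us"
      using nth_part_pos[OF that(1), of "length us"] by (auto simp: nth_part_def)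
    then show False using that(2)[of "length us"] by simp
  qed
  have l: "length xs = length ys"
    using len[OF x, of ys] len[OF y, of xs] p by (intro antisym) auto
  show ?thesis
  proof (rule nth_equalityI[OF l])
    fix i assume "i < length xs"
    then show "xs ! i = ys ! i" using p[of "Suc i"] l by (simp add: nth_part_def)
  qed
qed

lemma conjugate_exists:
  assumes x: "partition_of N xs"
  shows "\<exists>ys. (\<exists>M. partition_of M ys) \<and>
     (\<forall>i j. (i, j) \<in> young_diagram ys \<longleftrightarrow> (j, i) \<in> young_diagram xs)"
proof -
  define S where "S j = {i. 1 \<le> i \<and> i \<le> length xs \<and> j \<le> nth_part xs i}" for j
  define c where "c j = card (S j)" for j
  have fin: "finite (S j)" for j by (rule finite_subset[of _ "{..length xs}"]) (auto simp: S_def)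
  have S_iff: "i \<in> S j \<longleftrightarrow> 1 \<le> i \<and> i \<le> c j" for i j
  proof
    assume i: "i \<in> S j"
    have "{1..i} \<subseteq> S j"
      using i nth_part_antimono[OF x] by (auto simp: S_def) (meson One_nat_def order_trans)
    then have "card {1..i} \<le> c j" unfolding c_def by (intro card_mono fin)
    then show "1 \<le> i \<and> i \<le> c j" using i by (auto simp: S_def)
  next
    assume i: "1 \<le> i \<and> i \<le> c j"
    show "i \<in> S j"
    proof (rule ccontr)
      assume n: "i \<notin> S j"
      have "S j \<subseteq> {1..<i}"
      proof
        fix k assume k: "k \<in> S j"
        have "k < i"
        proof (rule ccontr)
          assume "\<not> k < i"
          then have "i \<in> S j" using k i nth_part_antimono[OF x, of i k] by (auto simp: S_def)
          then show False using n by simp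
        qed
        then show "k \<in> {1..<i}" using k by (auto simp: S_def)
      qed
      then have "c j \<le> card {1..<i}" unfolding c_def by (intro card_mono) auto
      then show False using i by auto
    qed
  qed
  define ys where "ys = map c [1..<Suc (nth_part xs 1)]"
  have len: "length ys = nth_part xs 1" by (simp add: ys_def)
  have anti: "c k \<le> c j" if "j \<le> k" for j k
    unfolding c_def using that by (intro card_mono fin) (auto simp: S_def)
  have nth_part_ys: "nth_part ys j = c j" if "1 \<le> j" for j
  proof (cases "j \<le> nth_part xs 1")
    case True
    then have "ys ! (j - 1) = c j" using that unfolding ys_def by (subst nth_map) (auto simp del: upt_Suc)
    then show ?thesis using that True len by (simp add: nth_part_def[of ys])
  next
    case False
    have "S j = {}"
    proof (rule ccontr)
      assume "S j \<noteq> {}"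
      then obtain i where "i \<in> S j" by auto
      then have "j \<le> nth_part xs i" "1 \<le> i" by (auto simp: S_def)
      then show False using False nth_part_antimono[OF x, of 1 i] by simp
    qed
    then show ?thesis using False that by (simp add: nth_part_def[of ys] len c_def)
  qed
  have pos: "c j > 0" if "1 \<le> j" "j \<le> nth_part xs 1" for j
  proof -
    have "1 \<in> S j" using that by (auto simp: S_def nth_part_def split: if_splits)
    then show ?thesis using fin by (auto simp: c_def card_gt_0_iff)
  qed
  have "sorted_wrt (\<ge>) ys"
    unfolding ys_def sorted_wrt_map
    by (rule sorted_wrt_mono_rel[of _ "(\<le>)"]) (auto intro: anti simp del: upt_Suc)
  moreover have "\<forall>y \<in> set ys. y > 0" using pos by (auto simp: ys_def simp del: upt_Suc)
  ultimately have "partition_of (sum_list ys) ys" by (simp add: partition_of_def)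
  moreover have "(i, j) \<in> young_diagram ys \<longleftrightarrow> (j, i) \<in> young_diagram xs" for i j
  proof (cases "1 \<le> i")
    case True
    then have "(i, j) \<in> young_diagram ys \<longleftrightarrow> j \<in> S i"
      by (simp add: mem_young_diagram nth_part_ys S_iff)
    also have "\<dots> \<longleftrightarrow> (j, i) \<in> young_diagram xs"
      using True by (auto simp: S_def young_diagram_def)
    finally show ?thesis .
  qed (auto simp: young_diagram_def)
  ultimately show ?thesis by blast
qed

lemma conjugate_correct:
  assumes "partition_of N xs"
  shows "\<exists>M. partition_of M (conjugate xs)"
    and "(i, j) \<in> young_diagram (conjugate xs) \<longleftrightarrow> (j, i) \<in> young_diagram xs"
proof -
  let ?P = "\<lambda>ys. (\<exists>M. partition_of M ys) \<and>
     (\<forall>i j. (i, j) \<in> young_diagram ys \<longleftrightarrow> (j, i) \<in> young_diagram xs)"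
  obtain ys where ys: "?P ys" using conjugate_exists[OF assms] by blast
  have "zs = ys" if "?P zs" for zs
  proof -
    have "young_diagram zs = young_diagram ys" using that ys by auto
    then show ?thesis using that ys partition_eq_if_diagram_eq by blast
  qed
  then have "?P (conjugate xs)" unfolding conjugate_def using ys by (intro theI[of ?P]) blast+
  then show "\<exists>M. partition_of M (conjugate xs)"
    and "(i, j) \<in> young_diagram (conjugate xs) \<longleftrightarrow> (j, i) \<in> young_diagram xs" by blast+
qed

end

(* For each row and each column, k times the k-th part is at most N, so the k-th summand of
   sum_k binom(lambda_k, 2) / binom(N, 2) is dominated by 1/k^2 uniformly in n, and Tannery's theorem
   allows passing to the limit termwise. The content sum equals the difference of
   the row and column sums exactly, since the linear terms sum_i lambda_i = N = sum_j lambda'_j cancel. *)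

theory Submission
  imports Defs
begin

lemma young_diagram_Sigma:
  "young_diagram xs = (SIGMA i:{1..length xs}. {1..nth_part xs i})"
  by (auto simp: young_diagram_def)

lemma finite_young_diagram: "finite (young_diagram xs)"
  by (simp add: young_diagram_Sigma)

lemma sum_young_diagram_rows:
  "(\<Sum>(i, j)\<in>young_diagram xs. f i j) = (\<Sum>i=1..length xs. \<Sum>j=1..nth_part xs i. f i j)"
  unfolding young_diagram_Sigma by (subst sum.Sigma) auto

lemma sum_nth_part: "(\<Sum>i=1..length xs. nth_part xs i) = sum_list xs"
proof -
  have "(\<Sum>i=1..length xs. nth_part xs i) = (\<Sum>i=0..<length xs. xs ! i)"
    by (rule sum.reindex_bij_witness[of _ Suc "\<lambda>i. i - 1"]) (auto simp: nth_part_def)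
  then show ?thesis by (simp add: sum_list_sum_nth)
qed

lemma card_young_diagram: "card (young_diagram xs) = sum_list xs"
  by (simp add: young_diagram_Sigma flip: sum_nth_part)

text \<open>As an image under the injective map \<open>prod.swap\<close>, the transpose can be used
  directly to carry over both box counts and sums over boxes.\<close>

lemma young_diagram_conjugate:
  assumes "partition_of N xs"
  shows "young_diagram (conjugate xs) = prod.swap ` young_diagram xs"
  using conjugate_correct(2)[OF assms] by force

text \<open>\<open>conjugate_correct\<close> only provides some size \<open>M\<close>. Transposition
  preserves the number of boxes, which is the size, so \<open>M\<close> must be
  \<open>N\<close>.\<close>

lemma partition_of_conjugate:
  assumes "partition_of N xs"
  shows "partition_of N (conjugate xs)"
proof -
  obtain M where M: "partition_of M (conjugate xs)" using conjugate_correct(1)[OF assms] by blast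
  have "card (young_diagram (conjugate xs)) = card (young_diagram xs)"
    by (simp add: young_diagram_conjugate[OF assms] card_image)
  then show ?thesis using M assms by (simp add: card_young_diagram partition_of_def)
qed

text \<open>Rows 1 to k are each at least as long as row k, so the diagram contains a full rectangle
  with k rows and \<open>nth_part xs k\<close> columns.\<close>

lemma mult_nth_part_le:
  assumes "partition_of N xs" "1 \<le> k"
  shows "k * nth_part xs k \<le> N"
proof -
  have "{1..k} \<times> {1..nth_part xs k} \<subseteq> young_diagram xs"
    by (auto simp: mem_young_diagram intro: order.trans[OF _ nth_part_antimono[OF assms(1), simplified]])
  then have "card ({1..k} \<times> {1..nth_part xs k}) \<le> card (young_diagram xs)"
    by (rule card_mono[OF finite_young_diagram])
  then show ?thesis
    using assms by (simp add: card_young_diagram partition_of_def)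
qed

lemma real_choose_two: "real (n choose 2) = real n * (real n - 1) / 2"
  by (induction n) (auto simp: numeral_2_eq_2 field_simps)

lemma infsum_nth_part_choose_two:
  "(\<Sum>\<^sub>\<infinity>i\<in>{1..}. real (nth_part xs i choose 2)) = (\<Sum>i=1..length xs. real (nth_part xs i choose 2))"
proof -
  have "(\<Sum>\<^sub>\<infinity>i\<in>{1..}. real (nth_part xs i choose 2))
      = (\<Sum>\<^sub>\<infinity>i\<in>{1..length xs}. real (nth_part xs i choose 2))"
    \<comment> \<open>Past the last row the padding value 0 gives
      \<open>0 choose 2 = 0\<close>.\<close>
    by (rule infsum_cong_neutral) (auto simp: nth_part_def)
  then show ?thesis by simp
qed

text \<open>A row of length m contributes 1 + ... + m, which is \<open>m choose 2\<close> plus m.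
  The linear terms add up to the size of the partition.\<close>

lemma sum_column_indices:
  assumes "partition_of N xs"
  shows "(\<Sum>(i, j)\<in>young_diagram xs. real j)
    = (\<Sum>\<^sub>\<infinity>i\<in>{1..}. real (nth_part xs i choose 2)) + real N"
proof -
  have gauss: "(\<Sum>j=1..m. real j) = real (m choose 2) + real m" for m
    by (induction m) (auto simp: real_choose_two field_simps)
  have "real N = (\<Sum>i=1..length xs. real (nth_part xs i))"
    using assms by (simp add: partition_of_def flip: sum_nth_part of_nat_sum)
  then show ?thesis
    unfolding sum_young_diagram_rows gauss sum.distrib infsum_nth_part_choose_two by simp
qed

lemma content_sum:
  assumes "partition_of N xs"
  shows "(\<Sum>(i, j)\<in>young_diagram xs. real j - real i)
    = (\<Sum>\<^sub>\<infinity>i\<in>{1..}. real (nth_part xs i choose 2))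
      - (\<Sum>\<^sub>\<infinity>j\<in>{1..}. real (nth_part (conjugate xs) j choose 2))"
proof -
  \<comment> \<open>Row indices become column indices after transposing, so
    \<open>sum_column_indices\<close> handles both halves of the content sum.\<close>
  have "(\<Sum>(i, j)\<in>young_diagram (conjugate xs). real j) = (\<Sum>(i, j)\<in>young_diagram xs. real i)"
    unfolding young_diagram_conjugate[OF assms]
    by (subst sum.reindex) (auto simp: case_prod_unfold)
  then show ?thesis
    using sum_column_indices[OF assms] sum_column_indices[OF partition_of_conjugate[OF assms]]
    by (simp add: case_prod_unfold sum_subtractf)
qed

text \<open>Since k is at least 1, \<open>k * a \<le> N\<close> also yields k(a - 1) \<le> N - 1.
  Multiplying the two inequalities produces the factor k squared. For a < 2 the left side is
  0.\<close>

lemma choose_two_ratio_le: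
  assumes "k * a \<le> N" "1 \<le> k"
  shows "real (a choose 2) / real (N choose 2) \<le> 1 / (real k)\<^sup>2"
proof (cases "2 \<le> a")
  case True
  have aN: "a \<le> N" using assms by (metis le_trans mult_le_mono1 nat_mult_1)
  have ka: "real k * real a \<le> real N" using assms(1) by (simp flip: of_nat_mult)
  have k1: "1 \<le> real k" using assms(2) by simp
  have "real k * (real a - 1) \<le> real N - 1" using ka k1 by (simp add: algebra_simps)
  then have "(real k * real a) * (real k * (real a - 1)) \<le> real N * (real N - 1)"
    using ka True aN by (intro mult_mono) auto
  then have "real a * (real a - 1) * (real k)\<^sup>2 \<le> real N * (real N - 1)"
    by (simp add: power2_eq_square mult_ac)
  moreover have "real N * (real N - 1) > 0" using True aN by auto
  moreover have "x / 2 / (y / 2) \<le> 1 / z" if "x * z \<le> y" "y > 0" "z > 0" for x y z :: real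
    using that by (simp add: field_simps)
  ultimately show ?thesis using k1 unfolding real_choose_two by simp
qed (auto simp: binomial_eq_0)

lemma tendsto_choose_two_ratio:
  fixes a N :: "nat \<Rightarrow> nat"
  assumes N: "filterlim N at_top sequentially"
    and lim: "(\<lambda>n. real (a n) / real (N n)) \<longlonglongrightarrow> c"
  shows "(\<lambda>n. real (a n choose 2) / real (N n choose 2)) \<longlonglongrightarrow> c\<^sup>2"
proof -
  have inv: "(\<lambda>n. 1 / real (N n)) \<longlonglongrightarrow> 0"
    using filterlim_compose[OF lim_1_over_n N] by simp
  \<comment> \<open>This is a(a - 1) / (N(N - 1)) with numerator and denominator divided by N
    squared. The two expressions agree once N is at least 2, which holds eventually.\<close>
  have "(\<lambda>n. real (a n) / real (N n) * (real (a n) / real (N n) - 1 / real (N n))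
        / (1 - 1 / real (N n))) \<longlonglongrightarrow> c * (c - 0) / (1 - 0)"
    by (intro tendsto_intros lim inv) auto
  moreover have "\<forall>\<^sub>F n in sequentially. real (a n) / real (N n) * (real (a n) / real (N n) - 1 / real (N n))
        / (1 - 1 / real (N n)) = real (a n choose 2) / real (N n choose 2)"
    using filterlim_at_top[THEN iffD1, OF N, rule_format, of 2]
  proof eventually_elim
    case (elim n)
    then show ?case by (simp add: real_choose_two divide_simps)
  qed
  ultimately show ?thesis by (simp add: power2_eq_square tendsto_cong)
qed

text \<open>Bridges the series indexed from 0 in Tannery's theorem and the unordered sums over
  \<open>{1..}\<close>. Nonnegativity makes the convergence unconditional.\<close>

lemma has_sum_atLeast_1:
  fixes f :: "nat \<Rightarrow> real"
  assumes "summable (\<lambda>k. f (Suc k))" "\<And>k. f (Suc k) \<ge> 0"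
  shows "(f has_sum (\<Sum>k. f (Suc k))) {1..}"
proof -
  have "((\<lambda>k. f (Suc k)) has_sum (\<Sum>k. f (Suc k))) UNIV"
    by (intro sums_nonneg_imp_has_sum summable_sums assms)
  then show ?thesis
    by (rule has_sum_reindex_bij_witness[of _ "\<lambda>i. i - 1" Suc, THEN iffD1, rotated -1]) auto
qed

text \<open>Stated for an arbitrary sequence \<open>mu\<close> so that it serves the rows, with
  \<open>lam\<close>, and the columns, with the conjugates.\<close>

lemma partition_choose_two_limit:
  fixes N :: "nat \<Rightarrow> nat" and mu :: "nat \<Rightarrow> nat list" and c :: "nat \<Rightarrow> real"
  assumes part: "\<And>n. n \<ge> 1 \<Longrightarrow> partition_of (N n) (mu n)"
    and N: "filterlim N at_top sequentially"
    and lim: "\<And>i. i \<ge> 1 \<Longrightarrow> (\<lambda>n. real (nth_part (mu n) i) / real (N n)) \<longlonglongrightarrow> c i"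
  shows "(\<lambda>i. (c i)\<^sup>2) summable_on {1..}"
    and "(\<lambda>n. (\<Sum>\<^sub>\<infinity>i\<in>{1..}. real (nth_part (mu n) i choose 2)) / real (N n choose 2))
      \<longlonglongrightarrow> (\<Sum>\<^sub>\<infinity>i\<in>{1..}. (c i)\<^sup>2)"
proof -
  define r where "r i n = real (nth_part (mu n) i choose 2) / real (N n choose 2)" for i n
  have r_le: "norm (r (Suc k) n) \<le> 1 / (real (Suc k))\<^sup>2" if "n \<ge> 1" for k n
    using choose_two_ratio_le[OF mult_nth_part_le[OF part[OF that]], of "Suc k"] by (simp add: r_def)
  have M: "summable (\<lambda>k. 1 / (real (Suc k))\<^sup>2)"
    using inverse_power_summable[where 'a = real, of 2] by (subst summable_Suc_iff) (simp add: inverse_eq_divide)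
  have "(\<lambda>n. r (Suc k) n) \<longlonglongrightarrow> (c (Suc k))\<^sup>2" for k
    unfolding r_def by (intro tendsto_choose_two_ratio N lim) simp
  \<comment> \<open>The bound holds for every k, but only for n at least 1, where
    \<open>mu n\<close> is known to be a partition; hence the two witnesses.\<close>
  moreover have "\<forall>\<^sub>F (k, n) in sequentially \<times>\<^sub>F sequentially. norm (r (Suc k) n) \<le> 1 / (real (Suc k))\<^sup>2"
    unfolding eventually_prod_filter
    by (rule exI[of _ "\<lambda>_. True"], rule exI[of _ "\<lambda>n. n \<ge> 1"])
       (use r_le eventually_ge_at_top in auto)
  \<comment> \<open>Besides the interchange of limit and sum, Tannery's theorem gives summability of
    the limiting terms, which is the first claim.\<close>
  ultimately have tannery: "summable (\<lambda>k. norm ((c (Suc k))\<^sup>2))"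
      "(\<lambda>n. \<Sum>k. r (Suc k) n) \<longlonglongrightarrow> (\<Sum>k. (c (Suc k))\<^sup>2)"
    using tannerys_theorem[of "\<lambda>k n. r (Suc k) n" "\<lambda>k. (c (Suc k))\<^sup>2" sequentially] M by auto
  have c_sum: "((\<lambda>i. (c i)\<^sup>2) has_sum (\<Sum>k. (c (Suc k))\<^sup>2)) {1..}"
    using tannery(1) by (intro has_sum_atLeast_1) auto
  then show "(\<lambda>i. (c i)\<^sup>2) summable_on {1..}" by (rule has_sum_imp_summable)
  have "(\<Sum>k. r (Suc k) n)
      = (\<Sum>\<^sub>\<infinity>i\<in>{1..}. real (nth_part (mu n) i choose 2)) / real (N n choose 2)" if "n \<ge> 1" for n
  proof -
    \<comment> \<open>The same dominating series works at each fixed n.\<close>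
    have "summable (\<lambda>k. r (Suc k) n)"
      by (rule summable_comparison_test'[OF M]) (use r_le that in auto)
    then have "((\<lambda>i. r i n) has_sum (\<Sum>k. r (Suc k) n)) {1..}"
      by (intro has_sum_atLeast_1) (auto simp: r_def)
    then show ?thesis
      unfolding r_def divide_inverse infsum_cmult_left'[symmetric] by (simp add: infsumI)
  qed
  then have "\<forall>\<^sub>F n in sequentially. (\<Sum>k. r (Suc k) n)
      = (\<Sum>\<^sub>\<infinity>i\<in>{1..}. real (nth_part (mu n) i choose 2)) / real (N n choose 2)"
    by (auto simp: eventually_sequentially)
  then show "(\<lambda>n. (\<Sum>\<^sub>\<infinity>i\<in>{1..}. real (nth_part (mu n) i choose 2)) / real (N n choose 2))
      \<longlonglongrightarrow> (\<Sum>\<^sub>\<infinity>i\<in>{1..}. (c i)\<^sup>2)"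
    using tannery(2) infsumI[OF c_sum] by (simp add: tendsto_cong)
qed

theorem mainTheorem2:
  fixes N :: "nat \<Rightarrow> nat" and lam :: "nat \<Rightarrow> nat list" and p q :: "nat \<Rightarrow> real"
  assumes "\<And>n. n \<ge> 1 \<Longrightarrow> N n > 0"
    and "\<And>n. n \<ge> 1 \<Longrightarrow> partition_of (N n) (lam n)"
    and "filterlim N at_top sequentially"
    and "\<And>i. i \<ge> 1 \<Longrightarrow> (\<lambda>n. real (nth_part (lam n) i) / real (N n)) \<longlonglongrightarrow> p i"
    and "\<And>j. j \<ge> 1 \<Longrightarrow> (\<lambda>n. real (nth_part (conjugate (lam n)) j) / real (N n)) \<longlonglongrightarrow> q j"
  shows "(\<lambda>i. (p i)\<^sup>2) summable_on {1..} \<and> (\<lambda>j. (q j)\<^sup>2) summable_on {1..} \<and>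
    (\<lambda>n. (\<Sum>(i, j)\<in>young_diagram (lam n). real j - real i) / real (N n choose 2))
      \<longlonglongrightarrow> ((\<Sum>\<^sub>\<infinity>i\<in>{1..}. (p i)\<^sup>2) - (\<Sum>\<^sub>\<infinity>j\<in>{1..}. (q j)\<^sup>2)) \<and>
    (\<lambda>n. ((\<Sum>\<^sub>\<infinity>i\<in>{1..}. real (nth_part (lam n) i choose 2))
           - (\<Sum>\<^sub>\<infinity>j\<in>{1..}. real (nth_part (conjugate (lam n)) j choose 2)))
         / real (N n choose 2))
      \<longlonglongrightarrow> ((\<Sum>\<^sub>\<infinity>i\<in>{1..}. (p i)\<^sup>2) - (\<Sum>\<^sub>\<infinity>j\<in>{1..}. (q j)\<^sup>2))"
proof -
  note rows = partition_choose_two_limit[OF assms(2,3,4)]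
  note cols = partition_choose_two_limit[OF partition_of_conjugate[OF assms(2)] assms(3,5)]
  have lim: "(\<lambda>n. ((\<Sum>\<^sub>\<infinity>i\<in>{1..}. real (nth_part (lam n) i choose 2))
           - (\<Sum>\<^sub>\<infinity>j\<in>{1..}. real (nth_part (conjugate (lam n)) j choose 2)))
         / real (N n choose 2))
      \<longlonglongrightarrow> ((\<Sum>\<^sub>\<infinity>i\<in>{1..}. (p i)\<^sup>2) - (\<Sum>\<^sub>\<infinity>j\<in>{1..}. (q j)\<^sup>2))"
    unfolding diff_divide_distrib by (intro tendsto_diff rows(2) cols(2)) auto
  \<comment> \<open>The content identity is available for n at least 1, so the two sequences agree
    eventually and share their limit.\<close>
  have "\<forall>\<^sub>F n in sequentially. (\<Sum>(i, j)\<in>young_diagram (lam n). real j - real i) / real (N n choose 2)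
      = ((\<Sum>\<^sub>\<infinity>i\<in>{1..}. real (nth_part (lam n) i choose 2))
           - (\<Sum>\<^sub>\<infinity>j\<in>{1..}. real (nth_part (conjugate (lam n)) j choose 2)))
         / real (N n choose 2)"
    using eventually_ge_at_top[of 1] by eventually_elim (simp add: content_sum[OF assms(2)])
  from tendsto_cong[OF this, THEN iffD2, OF lim] show ?thesis
    using lim rows(1) cols(1) by blast
qed

end
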